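(* Fix an integer $s\ge1$ and consider the combinatorial Hopf algebra $(\mathcal{A},\zeta_s)$. For every simplicial complex $\Gamma$, $\Psi_{\zeta_s}(\Gamma)=\psi_s(\Gamma;x_1,x_2,\dots)$.
   Context: $\mathcal{A}=\bigoplus_{n\ge0}A_n$ is the Hopf algebra over a field $\mathbb{K}$ where $A_n$ is spanned by isomorphism classes of finite simplicial complexes on $n$ vertices; product is disjoint union, coproduct $\Delta(\Gamma)=\sum_{T\subseteq V(\Gamma)}\Gamma_T\otimes\Gamma_{V(\Gamma)-T}$ where $V(\Gamma)$ is the vertex set and $\Gamma_T=\{X\cap T:X\in\Gamma\}$. The character $\zeta_s:\mathcal{A}\to\mathbb{K}$ is $\zeta_s(\Gamma)=1$ if $\dim\Gamma<s$ and $0$ otherwise (dimension of a face $X$ is $|X|-1$). For a composition $\alpha=(\alpha_1,\dots,\alpha_k)$ of $n$, $M_\alpha=\sum_{i_1<\dots<i_k}x_{i_1}^{\alpha_1}\cdots x_{i_k}^{\alpha_k}$ is the monomial quasi-symmetric function. For $\Gamma\in A_n$, $\Psi_{\zeta_s}(\Gamma)=\sum_{\alpha\vDash n}\zeta_{s,\alpha}(\Gamma)M_\alpha$, where $\zeta_{s,\alpha}$ is the composite $\mathcal{A}\xrightarrow{\Delta^{k-1}}\mathcal{A}^{\otimes k}\to A_{\alpha_1}\otimes\cdots\otimes A_{\alpha_k}\xrightarrow{\zeta_s^{\otimes k}}\mathbb{K}$ (iterated coproduct, then canonical projection). An $s$-simplicial coloring of $\Gamma$ is a map $f:V(\Gamma)\to\mathbb{P}=\{1,2,\dots\}$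 such that every face of $\Gamma$ contains at most $s$ vertices of any given color. The $s$-chromatic symmetric function is $\psi_s(\Gamma;x_1,x_2,\dots)=\sum_f\prod_{i\ge1}x_i^{|f^{-1}(i)|}$, summed over all $s$-simplicial colorings $f$. *)

theory Defs
  imports "HOL-Library.Poly_Mapping" "HOL-Library.FuncSet"
begin

section \<open>Finite simplicial complexes and their isomorphism classes\<close>

text \<open>A complex always has the empty face, so the complex on no vertices is \<open>{{}}\<close>, and
  every vertex is a face.\<close>

definition simplicial_complex :: "'v set set \<Rightarrow> bool" where
  "simplicial_complex \<Gamma> \<longleftrightarrow>
     finite \<Gamma> \<and> (\<forall>X\<in>\<Gamma>. finite X) \<and> {} \<in> \<Gamma> \<and> (\<forall>X\<in>\<Gamma>. \<forall>Y. Y \<subseteq> X \<longrightarrow> Y \<in> \<Gamma>)"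

definition verts :: "'v set set \<Rightarrow> 'v set" where
  "verts \<Gamma> = \<Union>\<Gamma>"

definition dimension :: "'v set set \<Rightarrow> int" where
  "dimension \<Gamma> = Max ((\<lambda>X. int (card X) - 1) ` \<Gamma>)"

definition induced :: "'v set set \<Rightarrow> 'v set \<Rightarrow> 'v set set" where
  "induced \<Gamma> T = {X \<inter> T | X. X \<in> \<Gamma>}"

definition disjoint_union :: "'v set set \<Rightarrow> 'w set set \<Rightarrow> ('v + 'w) set set" where
  "disjoint_union \<Gamma> \<Gamma>' = (`) Inl ` \<Gamma> \<union> (`) Inr ` \<Gamma>'"

definition complex_iso :: "'v set set \<Rightarrow> 'w set set \<Rightarrow> bool" where
  "complex_iso \<Gamma> \<Gamma>' \<longleftrightarrow> (\<exists>f. bij_betw f (verts \<Gamma>) (verts \<Gamma>') \<and> \<Gamma>' = (`) f ` \<Gamma>)"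

text \<open>Every finite complex is isomorphic to one with vertices in \<open>nat\<close>; an isomorphism
  class is represented by the set of all its members of this kind.\<close>

definition nat_iso_class :: "'v set set \<Rightarrow> nat set set set" where
  "nat_iso_class \<Gamma> = {\<Gamma>'. simplicial_complex \<Gamma>' \<and> complex_iso \<Gamma> \<Gamma>'}"

typedef iso_class = "{nat_iso_class \<Gamma> | \<Gamma> :: nat set set. simplicial_complex \<Gamma>}"
proof -
  have "simplicial_complex {{}}" by (simp add: simplicial_complex_def)
  then show ?thesis by blast
qed

definition iso_class_of :: "'v set set \<Rightarrow> iso_class" where
  "iso_class_of \<Gamma> = Abs_iso_class (nat_iso_class \<Gamma>)"

definition representative :: "iso_class \<Rightarrow> nat set set" where
  "representative c = (SOME \<Gamma>. \<Gamma> \<in> Rep_iso_class c)"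

definition num_verts :: "iso_class \<Rightarrow> nat" where
  "num_verts c = card (verts (representative c))"

lemma finite_verts: "simplicial_complex \<Gamma> \<Longrightarrow> finite (verts \<Gamma>)"
  unfolding simplicial_complex_def verts_def by auto

lemma complex_iso_refl: "complex_iso \<Gamma> \<Gamma>"
  unfolding complex_iso_def by (rule exI[of _ id]) auto

lemma verts_image: "verts ((`) f ` \<Gamma>) = f ` verts \<Gamma>"
  unfolding verts_def by auto

lemma complex_iso_image: "inj_on f (verts \<Gamma>) \<Longrightarrow> complex_iso \<Gamma> ((`) f ` \<Gamma>)"
  unfolding complex_iso_def by (rule exI[of _ f]) (auto simp: verts_image bij_betw_def)

lemma complex_isoE:
  assumes "complex_iso \<Gamma> \<Gamma>'"
  obtains f where "inj_on f (verts \<Gamma>)" "\<Gamma>' = (`) f ` \<Gamma>"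
  using assms unfolding complex_iso_def bij_betw_def by auto

lemma complex_iso_sym:
  assumes "complex_iso \<Gamma> \<Gamma>'"
  shows "complex_iso \<Gamma>' \<Gamma>"
proof -
  obtain f where f: "inj_on f (verts \<Gamma>)" "\<Gamma>' = (`) f ` \<Gamma>" using assms by (rule complex_isoE)
  let ?g = "inv_into (verts \<Gamma>) f"
  have "?g ` (f ` X) = X" if "X \<in> \<Gamma>" for X
    using inv_into_image_cancel[OF f(1), of X] that by (auto simp: verts_def)
  then have "(`) ?g ` \<Gamma>' = \<Gamma>"
    unfolding f(2) by (simp add: image_image)
  moreover have "inj_on ?g (verts \<Gamma>')"
    unfolding f(2) verts_image by (rule inj_on_inv_into) simp
  ultimately show ?thesis using complex_iso_image[of ?g \<Gamma>'] by simp
qed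

lemma complex_iso_trans:
  assumes "complex_iso \<Gamma>1 \<Gamma>2" "complex_iso \<Gamma>2 \<Gamma>3"
  shows "complex_iso \<Gamma>1 \<Gamma>3"
proof -
  obtain f where f: "inj_on f (verts \<Gamma>1)" "\<Gamma>2 = (`) f ` \<Gamma>1" using assms(1) by (rule complex_isoE)
  obtain g where g: "inj_on g (verts \<Gamma>2)" "\<Gamma>3 = (`) g ` \<Gamma>2" using assms(2) by (rule complex_isoE)
  have "(`) (g \<circ> f) ` \<Gamma>1 = \<Gamma>3" unfolding g(2) f(2) by (simp add: image_image)
  moreover have "inj_on (g \<circ> f) (verts \<Gamma>1)"
    using f g by (simp add: comp_inj_on verts_image)
  ultimately show ?thesis using complex_iso_image[of "g \<circ> f" \<Gamma>1] by (simp only:)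
qed

lemma simplicial_complex_image:
  assumes "simplicial_complex \<Gamma>"
  shows "simplicial_complex ((`) f ` \<Gamma>)"
  unfolding simplicial_complex_def
proof (intro conjI ballI allI impI)
  show "finite ((`) f ` \<Gamma>)" "{} \<in> (`) f ` \<Gamma>" "\<And>X. X \<in> (`) f ` \<Gamma> \<Longrightarrow> finite X"
    using assms by (auto simp: simplicial_complex_def)
  fix X Y assume "X \<in> (`) f ` \<Gamma>" "Y \<subseteq> X"
  then obtain Z where Z: "Z \<in> \<Gamma>" "Y \<subseteq> f ` Z" by auto
  then obtain Z' where "Z' \<subseteq> Z" "Y = f ` Z'" by (auto simp: subset_image_iff)
  then show "Y \<in> (`) f ` \<Gamma>" using Z assms by (auto simp: simplicial_complex_def)
qed

lemma nat_iso_class_eq: "complex_iso \<Gamma> \<Gamma>' \<Longrightarrow> nat_iso_class \<Gamma> = nat_iso_class \<Gamma>'"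
  unfolding nat_iso_class_def by (auto intro: complex_iso_trans dest: complex_iso_sym)

lemma ex_nat_complex:
  assumes "simplicial_complex \<Gamma>"
  obtains \<Gamma>' :: "nat set set" where "simplicial_complex \<Gamma>'" "complex_iso \<Gamma> \<Gamma>'"
proof -
  obtain f :: "'a \<Rightarrow> nat" where "inj_on f (verts \<Gamma>)"
    using finite_imp_inj_to_nat_seg[OF finite_verts[OF assms]] by blast
  then show ?thesis
    using that[OF simplicial_complex_image[OF assms, of f]] complex_iso_image by blast
qed

lemma Rep_iso_class_of:
  assumes "simplicial_complex \<Gamma>"
  shows "Rep_iso_class (iso_class_of \<Gamma>) = nat_iso_class \<Gamma>"
proof -
  obtain \<Gamma>' :: "nat set set" where "simplicial_complex \<Gamma>'" "complex_iso \<Gamma> \<Gamma>'"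
    using assms by (rule ex_nat_complex)
  then have "nat_iso_class \<Gamma> \<in> {nat_iso_class \<Gamma> | \<Gamma> :: nat set set. simplicial_complex \<Gamma>}"
    using nat_iso_class_eq by blast
  then show ?thesis unfolding iso_class_of_def by (rule Abs_iso_class_inverse)
qed

lemma iso_class_of_eq_iff:
  assumes "simplicial_complex \<Gamma>" "simplicial_complex \<Gamma>'"
  shows "iso_class_of \<Gamma> = iso_class_of \<Gamma>' \<longleftrightarrow> complex_iso \<Gamma> \<Gamma>'"
proof
  assume "complex_iso \<Gamma> \<Gamma>'"
  then show "iso_class_of \<Gamma> = iso_class_of \<Gamma>'"
    unfolding iso_class_of_def by (simp add: nat_iso_class_eq)
next
  assume "iso_class_of \<Gamma> = iso_class_of \<Gamma>'"
  then have eq: "nat_iso_class \<Gamma> = nat_iso_class \<Gamma>'"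
    using Rep_iso_class_of assms by metis
  obtain \<Delta> :: "nat set set" where "simplicial_complex \<Delta>" "complex_iso \<Gamma> \<Delta>"
    using assms(1) by (rule ex_nat_complex)
  then have "\<Delta> \<in> nat_iso_class \<Gamma>" by (simp add: nat_iso_class_def)
  then have "complex_iso \<Gamma>' \<Delta>" by (simp add: eq) (simp add: nat_iso_class_def)
  then show "complex_iso \<Gamma> \<Gamma>'"
    by (rule complex_iso_trans[OF \<open>complex_iso \<Gamma> \<Delta>\<close> complex_iso_sym])
qed

lemma representative_mem: "representative c \<in> Rep_iso_class c"
proof -
  obtain \<Gamma> :: "nat set set" where "simplicial_complex \<Gamma>" "Rep_iso_class c = nat_iso_class \<Gamma>"
    using Rep_iso_class[of c] by auto
  then have "\<Gamma> \<in> Rep_iso_class c" by (simp add: nat_iso_class_def complex_iso_refl)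
  then show ?thesis unfolding representative_def by (rule someI)
qed

lemma simplicial_complex_representative: "simplicial_complex (representative c)"
  using representative_mem[of c] Rep_iso_class[of c] by (auto simp: nat_iso_class_def)

lemma iso_class_of_representative [simp]: "iso_class_of (representative c) = c"
proof -
  obtain \<Gamma> :: "nat set set" where \<Gamma>: "simplicial_complex \<Gamma>" "Rep_iso_class c = nat_iso_class \<Gamma>"
    using Rep_iso_class[of c] by auto
  then have "complex_iso \<Gamma> (representative c)"
    using representative_mem[of c] by (auto simp: nat_iso_class_def)
  then have "nat_iso_class (representative c) = Rep_iso_class c"
    using \<Gamma> by (simp add: nat_iso_class_eq)
  then show ?thesis by (simp add: iso_class_of_def Rep_iso_class_inverse)
qed

lemma complex_iso_representative:
  "simplicial_complex \<Gamma> \<Longrightarrow> complex_iso \<Gamma> (representative (iso_class_of \<Gamma>))"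
  using representative_mem[of "iso_class_of \<Gamma>"] by (simp add: Rep_iso_class_of nat_iso_class_def)

lemma num_verts_iso_class_of:
  assumes "simplicial_complex \<Gamma>"
  shows "num_verts (iso_class_of \<Gamma>) = card (verts \<Gamma>)"
  using complex_iso_representative[OF assms]
  unfolding num_verts_def complex_iso_def by (metis bij_betw_same_card)

lemma dimension_iso:
  assumes "complex_iso \<Gamma> \<Gamma>'"
  shows "dimension \<Gamma>' = dimension \<Gamma>"
proof -
  obtain f where f: "inj_on f (verts \<Gamma>)" "\<Gamma>' = (`) f ` \<Gamma>" using assms by (rule complex_isoE)
  have "card (f ` X) = card X" if "X \<in> \<Gamma>" for X
    using inj_on_subset[OF f(1), of X] that by (auto simp: verts_def intro: card_image)
  then have "(\<lambda>X. int (card X) - 1) ` \<Gamma>' = (\<lambda>X. int (card X) - 1) ` \<Gamma>"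
    unfolding f(2) image_image by (intro image_cong) auto
  then show ?thesis unfolding dimension_def by simp
qed

lemma dimension_representative:
  "simplicial_complex \<Gamma> \<Longrightarrow> dimension (representative (iso_class_of \<Gamma>)) = dimension \<Gamma>"
  using complex_iso_representative dimension_iso by blast

lemma simplicial_complex_induced:
  assumes "simplicial_complex \<Gamma>"
  shows "simplicial_complex (induced \<Gamma> T)"
  unfolding simplicial_complex_def
proof (intro conjI ballI allI impI)
  have "induced \<Gamma> T = (\<lambda>X. X \<inter> T) ` \<Gamma>" by (auto simp: induced_def)
  then show "finite (induced \<Gamma> T)" using assms by (simp add: simplicial_complex_def)
  show "{} \<in> induced \<Gamma> T" "\<And>X. X \<in> induced \<Gamma> T \<Longrightarrow> finite X"
    using assms by (auto simp: simplicial_complex_def induced_def)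
  fix X Y assume "X \<in> induced \<Gamma> T" "Y \<subseteq> X"
  then have "Y \<in> \<Gamma>" "Y \<inter> T = Y" using assms by (auto simp: simplicial_complex_def induced_def)
  then show "Y \<in> induced \<Gamma> T" unfolding induced_def by blast
qed

lemma verts_induced: "verts (induced \<Gamma> T) = verts \<Gamma> \<inter> T"
  by (auto simp: verts_def induced_def)

lemma induced_iso:
  assumes f: "inj_on f (verts \<Gamma>)" and T: "T \<subseteq> verts \<Gamma>"
  shows "complex_iso (induced \<Gamma> T) (induced ((`) f ` \<Gamma>) (f ` T))"
proof -
  have "f ` X \<inter> f ` T = f ` (X \<inter> T)" if "X \<in> \<Gamma>" for X
    using that f T inj_on_image_Int[OF f, of X T] by (auto simp: verts_def)
  then have "induced ((`) f ` \<Gamma>) (f ` T) = (`) f ` induced \<Gamma> T"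
    unfolding induced_def Setcompr_eq_image image_image by (intro image_cong) auto
  moreover have "inj_on f (verts (induced \<Gamma> T))"
    using f by (auto simp: verts_induced intro: inj_on_subset)
  ultimately show ?thesis by (simp add: complex_iso_image)
qed

lemma verts_disjoint_union: "verts (disjoint_union \<Gamma> \<Gamma>') = verts \<Gamma> <+> verts \<Gamma>'"
  by (auto simp: verts_def disjoint_union_def)

lemma simplicial_complex_disjoint_union:
  assumes "simplicial_complex \<Gamma>" "simplicial_complex \<Gamma>'"
  shows "simplicial_complex (disjoint_union \<Gamma> \<Gamma>')"
proof -
  have "simplicial_complex (A \<union> B)" if "simplicial_complex A" "simplicial_complex B"
    for A B :: "('a + 'b) set set"
    using that unfolding simplicial_complex_def by (simp add: ball_Un)
  then show ?thesis
    unfolding disjoint_union_def by (simp add: assms simplicial_complex_image)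
qed

lemma disjoint_union_iso:
  assumes "complex_iso \<Gamma>1 \<Gamma>2" "complex_iso \<Gamma>1' \<Gamma>2'"
  shows "complex_iso (disjoint_union \<Gamma>1 \<Gamma>1') (disjoint_union \<Gamma>2 \<Gamma>2')"
proof -
  obtain f where f: "inj_on f (verts \<Gamma>1)" "\<Gamma>2 = (`) f ` \<Gamma>1" using assms(1) by (rule complex_isoE)
  obtain g where g: "inj_on g (verts \<Gamma>1')" "\<Gamma>2' = (`) g ` \<Gamma>1'" using assms(2) by (rule complex_isoE)
  have "disjoint_union \<Gamma>2 \<Gamma>2' = (`) (map_sum f g) ` disjoint_union \<Gamma>1 \<Gamma>1'"
    unfolding f(2) g(2) disjoint_union_def by (simp add: image_Un image_image)
  moreover have "inj_on (map_sum f g) (verts (disjoint_union \<Gamma>1 \<Gamma>1'))"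
    by (auto simp: verts_disjoint_union intro!: inj_onI dest: inj_onD[OF f(1)] inj_onD[OF g(1)])
  ultimately show ?thesis by (simp add: complex_iso_image)
qed


section \<open>The algebra spanned by isomorphism classes\<close>

text \<open>Disjoint union makes isomorphism classes a commutative monoid, so \<open>iso_class \<Rightarrow>\<^sub>0 'k\<close>
  carries the library's monoid algebra structure, whose product is disjoint union.\<close>

instantiation iso_class :: comm_monoid_add
begin

definition zero_iso_class :: iso_class where
  "0 = iso_class_of ({{}} :: nat set set)"

definition plus_iso_class :: "iso_class \<Rightarrow> iso_class \<Rightarrow> iso_class" where
  "c + d = iso_class_of (disjoint_union (representative c) (representative d))"

lemma iso_class_of_disjoint_union:
  assumes "simplicial_complex \<Gamma>" "simplicial_complex \<Gamma>'"
  shows "iso_class_of (disjoint_union \<Gamma> \<Gamma>') = iso_class_of \<Gamma> + iso_class_of \<Gamma>'"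
  unfolding plus_iso_class_def
  by (simp add: iso_class_of_eq_iff simplicial_complex_disjoint_union assms
      simplicial_complex_representative disjoint_union_iso complex_iso_representative)

instance
proof
  fix a b c :: iso_class
  let ?A = "representative a" and ?B = "representative b" and ?C = "representative c"
  note sc = simplicial_complex_representative simplicial_complex_disjoint_union
  have ab: "iso_class_of (disjoint_union (representative x) (representative y)) = x + y" for x y
    by (simp add: plus_iso_class_def)
  have "(a + b) + c = iso_class_of (disjoint_union (disjoint_union ?A ?B) ?C)"
    by (subst iso_class_of_disjoint_union) (auto simp: sc ab)
  also have "\<dots> = iso_class_of (disjoint_union ?A (disjoint_union ?B ?C))"
  proof -
    let ?f = "case_sum (case_sum Inl (Inr \<circ> Inl)) (Inr \<circ> Inr)
      :: (nat + nat) + nat \<Rightarrow> nat + (nat + nat)"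
    have "disjoint_union ?A (disjoint_union ?B ?C)
        = (`) ?f ` disjoint_union (disjoint_union ?A ?B) ?C"
      by (simp add: disjoint_union_def image_Un image_image Un_assoc)
    moreover have "inj ?f" by (auto simp: inj_on_def split: sum.splits)
    ultimately have "complex_iso (disjoint_union (disjoint_union ?A ?B) ?C)
        (disjoint_union ?A (disjoint_union ?B ?C))"
      using complex_iso_image[OF inj_on_subset[OF _ subset_UNIV]] by (simp only:)
    then show ?thesis by (simp add: iso_class_of_eq_iff sc)
  qed
  also have "\<dots> = a + (b + c)"
    by (subst iso_class_of_disjoint_union) (auto simp: sc ab)
  finally show "a + b + c = a + (b + c)" .
  show "a + b = b + a"
  proof -
    let ?f = "case_sum Inr Inl :: nat + nat \<Rightarrow> nat + nat"
    have "disjoint_union ?B ?A = (`) ?f ` disjoint_union ?A ?B"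
      by (simp add: disjoint_union_def image_Un image_image Un_commute)
    moreover have "inj ?f" by (auto simp: inj_on_def split: sum.splits)
    ultimately have "complex_iso (disjoint_union ?A ?B) (disjoint_union ?B ?A)"
      using complex_iso_image[OF inj_on_subset[OF _ subset_UNIV]] by (simp only:)
    then show ?thesis by (simp add: plus_iso_class_def iso_class_of_eq_iff sc)
  qed
  show "0 + a = a"
  proof -
    let ?E = "{{}} :: nat set set"
    have E: "simplicial_complex ?E" by (simp add: simplicial_complex_def)
    have "{} \<in> ?A" using sc(1)[of a] by (simp add: simplicial_complex_def)
    then have "disjoint_union ?E ?A = (`) Inr ` ?A"
      by (auto simp: disjoint_union_def)
    moreover have "complex_iso ?A ((`) (Inr :: nat \<Rightarrow> nat + nat) ` ?A)"
      by (rule complex_iso_image) simp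
    ultimately have "complex_iso ?A (disjoint_union ?E ?A)" by (simp only:)
    then have "iso_class_of (disjoint_union ?E ?A) = iso_class_of ?A"
      using iso_class_of_eq_iff[OF sc(1)[of a] sc(2)[OF E sc(1)[of a]]] by metis
    moreover have "iso_class_of (disjoint_union ?E ?A) = 0 + a"
      using E by (simp add: iso_class_of_disjoint_union sc zero_iso_class_def)
    ultimately show ?thesis by simp
  qed
qed

end

text \<open>The tensor square is represented on the basis \<open>iso_class \<times> iso_class\<close>, and the \<open>k\<close>-th
  tensor power on the basis of lists of length \<open>k\<close>.\<close>

type_synonym 'k alg = "iso_class \<Rightarrow>\<^sub>0 'k"
type_synonym 'k alg2 = "(iso_class \<times> iso_class) \<Rightarrow>\<^sub>0 'k"
type_synonym 'k tensor = "iso_class list \<Rightarrow>\<^sub>0 'k"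

definition elem :: "'v set set \<Rightarrow> 'k::field alg" where
  "elem \<Gamma> = Poly_Mapping.single (iso_class_of \<Gamma>) 1"

definition linear_extension :: "('a \<Rightarrow> 'b \<Rightarrow>\<^sub>0 'k::field) \<Rightarrow> ('a \<Rightarrow>\<^sub>0 'k) \<Rightarrow> 'b \<Rightarrow>\<^sub>0 'k" where
  "linear_extension f h =
     (\<Sum>a\<in>Poly_Mapping.keys h. Poly_Mapping.map ((*) (Poly_Mapping.lookup h a)) (f a))"

definition linear_form :: "('a \<Rightarrow> 'k::field) \<Rightarrow> ('a \<Rightarrow>\<^sub>0 'k) \<Rightarrow> 'k" where
  "linear_form \<phi> h = (\<Sum>a\<in>Poly_Mapping.keys h. Poly_Mapping.lookup h a * \<phi> a)"

definition coproduct :: "'k::field alg \<Rightarrow> 'k alg2" where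
  "coproduct = linear_extension (\<lambda>c. let \<Gamma> = representative c in
     \<Sum>T\<in>Pow (verts \<Gamma>). Poly_Mapping.single
       (iso_class_of (induced \<Gamma> T), iso_class_of (induced \<Gamma> (verts \<Gamma> - T))) 1)"

definition counit :: "'k::field alg \<Rightarrow> 'k" where
  "counit = linear_form (\<lambda>c. if num_verts c = 0 then 1 else 0)"

definition zeta :: "nat \<Rightarrow> 'k::field alg \<Rightarrow> 'k" where
  "zeta s = linear_form (\<lambda>c. if dimension (representative c) < int s then 1 else 0)"

text \<open>The coproduct on the first tensor factor and the identity on the others; the value on
  the basis element of the zeroth tensor power is irrelevant.\<close>

definition coproduct_head :: "'k::field tensor \<Rightarrow> 'k tensor" where
  "coproduct_head = linear_extension (\<lambda>cs. case cs of [] \<Rightarrow> 0 | c # ds \<Rightarrow>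
     linear_extension (\<lambda>(a, b). Poly_Mapping.single (a # b # ds) 1)
       (coproduct (Poly_Mapping.single c 1)))"

text \<open>\<open>iterated_coproduct k\<close> is the \<open>(k - 1)\<close>-fold iterate of the coproduct, with values in the \<open>k\<close>-th tensor
  power; for \<open>k = 0\<close> (the empty composition) it is the counit.\<close>

fun iterated_coproduct :: "nat \<Rightarrow> 'k::field alg \<Rightarrow> 'k tensor" where
  "iterated_coproduct 0 h = Poly_Mapping.single [] (counit h)"
| "iterated_coproduct (Suc 0) h = linear_extension (\<lambda>c. Poly_Mapping.single [c] 1) h"
| "iterated_coproduct (Suc (Suc k)) h = coproduct_head (iterated_coproduct (Suc k) h)"

definition graded_projection :: "nat list \<Rightarrow> 'k::field tensor \<Rightarrow> 'k tensor" where
  "graded_projection \<alpha> =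
     linear_extension (\<lambda>cs. if map num_verts cs = \<alpha> then Poly_Mapping.single cs 1 else 0)"

definition tensor_power_form :: "('k::field alg \<Rightarrow> 'k) \<Rightarrow> 'k tensor \<Rightarrow> 'k" where
  "tensor_power_form \<zeta> = linear_form (\<lambda>cs. \<Prod>c\<leftarrow>cs. \<zeta> (Poly_Mapping.single c 1))"

definition character_at :: "('k::field alg \<Rightarrow> 'k) \<Rightarrow> nat list \<Rightarrow> 'k alg \<Rightarrow> 'k" where
  "character_at \<zeta> \<alpha> h =
     tensor_power_form \<zeta> (graded_projection \<alpha> (iterated_coproduct (length \<alpha>) h))"


section \<open>Formal power series\<close>

text \<open>An element of \<open>nat \<Rightarrow>\<^sub>0 nat\<close> is the exponent of a monomial, and a series maps exponents to
  coefficients. The variables are \<open>x\<^sub>1, x\<^sub>2, \<dots>\<close>: index \<open>0\<close> is not used.\<close>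

type_synonym 'k series = "(nat \<Rightarrow>\<^sub>0 nat) \<Rightarrow> 'k"

text \<open>The formal sum over \<open>i \<in> I\<close> of the monomials with exponent \<open>e i\<close>; it makes sense when
  each exponent occurs finitely often.\<close>

definition monomial_sum :: "'i set \<Rightarrow> ('i \<Rightarrow> nat \<Rightarrow>\<^sub>0 nat) \<Rightarrow> 'k::field series" where
  "monomial_sum I e = (\<lambda>m. of_nat (card {i \<in> I. e i = m}))"

definition compositions :: "nat \<Rightarrow> nat list set" where
  "compositions n = {\<alpha>. 0 \<notin> set \<alpha> \<and> sum_list \<alpha> = n}"

definition index_tuples :: "nat \<Rightarrow> nat list set" where
  "index_tuples k = {is. length is = k \<and> sorted_wrt (<) is \<and> set is \<subseteq> {1..}}"

definition monomial_quasisym :: "nat list \<Rightarrow> 'k::field series" where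
  "monomial_quasisym \<alpha> = monomial_sum (index_tuples (length \<alpha>))
     (\<lambda>is. \<Sum>j<length \<alpha>. Poly_Mapping.single (is ! j) (\<alpha> ! j))"

definition Psi :: "('k::field alg \<Rightarrow> 'k) \<Rightarrow> 'k alg \<Rightarrow> 'k series" where
  "Psi \<zeta> h = (\<lambda>m. linear_form (\<lambda>c. \<Sum>\<alpha>\<in>compositions (num_verts c).
     character_at \<zeta> \<alpha> (Poly_Mapping.single c 1) * monomial_quasisym \<alpha> m) h)"

text \<open>Colorings are taken to be \<open>undefined\<close> outside the vertex set, so that each map on the
  vertices is counted once.\<close>

definition simplicial_colorings :: "nat \<Rightarrow> 'v set set \<Rightarrow> ('v \<Rightarrow> nat) set" where
  "simplicial_colorings s \<Gamma> =
     {f \<in> verts \<Gamma> \<rightarrow>\<^sub>E {1..}. \<forall>X\<in>\<Gamma>. \<forall>i\<ge>1. card {v \<in> X. f v = i} \<le> s}"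

definition color_exponent :: "'v set set \<Rightarrow> ('v \<Rightarrow> nat) \<Rightarrow> nat \<Rightarrow>\<^sub>0 nat" where
  "color_exponent \<Gamma> f = Abs_poly_mapping (\<lambda>i. card {v \<in> verts \<Gamma>. f v = i})"

definition chromatic_series :: "nat \<Rightarrow> 'v set set \<Rightarrow> 'k::field series" where
  "chromatic_series s \<Gamma> = monomial_sum (simplicial_colorings s \<Gamma>) (color_exponent \<Gamma>)"


section \<open>Well-definedness\<close>

lemma linear_extension_single [simp]:
  "linear_extension f (Poly_Mapping.single a 1) = f a"
proof -
  have "Poly_Mapping.map ((*) 1) (f a) = f a"
    by (rule poly_mapping_eqI) (simp add: Poly_Mapping.map.rep_eq when_def)
  then show ?thesis by (simp add: linear_extension_def)
qed

lemma linear_form_single [simp]: "linear_form \<phi> (Poly_Mapping.single a 1) = \<phi> a"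
  by (simp add: linear_form_def)

lemma elem_disjoint_union:
  "simplicial_complex \<Gamma> \<Longrightarrow> simplicial_complex \<Gamma>' \<Longrightarrow>
     elem (disjoint_union \<Gamma> \<Gamma>') = (elem \<Gamma> * elem \<Gamma>' :: 'k::field alg)"
  by (simp add: elem_def iso_class_of_disjoint_union mult_single)

lemma coproduct_elem:
  assumes "simplicial_complex \<Gamma>"
  shows "coproduct (elem \<Gamma> :: 'k::field alg) = (\<Sum>T\<in>Pow (verts \<Gamma>). Poly_Mapping.single
    (iso_class_of (induced \<Gamma> T), iso_class_of (induced \<Gamma> (verts \<Gamma> - T))) 1)"
proof -
  define \<Gamma>' where "\<Gamma>' = representative (iso_class_of \<Gamma>)"
  have "complex_iso \<Gamma> \<Gamma>'" using complex_iso_representative[OF assms] by (simp add: \<Gamma>'_def)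
  then obtain f where f: "inj_on f (verts \<Gamma>)" "\<Gamma>' = (`) f ` \<Gamma>" by (rule complex_isoE)
  have V: "verts \<Gamma>' = f ` verts \<Gamma>" by (simp add: f(2) verts_image)
  have sc: "simplicial_complex \<Gamma>'" by (simp add: \<Gamma>'_def simplicial_complex_representative)
  have ind: "iso_class_of (induced \<Gamma>' (f ` T)) = iso_class_of (induced \<Gamma> T)"
    if "T \<subseteq> verts \<Gamma>" for T
    using induced_iso[OF f(1) that] assms sc complex_iso_sym
    by (simp add: f(2) iso_class_of_eq_iff simplicial_complex_induced)
  have "coproduct (elem \<Gamma> :: 'k alg) = (\<Sum>T\<in>Pow (verts \<Gamma>'). Poly_Mapping.single
    (iso_class_of (induced \<Gamma>' T), iso_class_of (induced \<Gamma>' (verts \<Gamma>' - T))) 1)"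
    by (simp add: coproduct_def elem_def \<Gamma>'_def Let_def)
  also have "\<dots> = (\<Sum>T\<in>Pow (verts \<Gamma>). Poly_Mapping.single
    (iso_class_of (induced \<Gamma>' (f ` T)), iso_class_of (induced \<Gamma>' (verts \<Gamma>' - f ` T))) 1)"
    by (rule sum.reindex_bij_betw[symmetric])
      (simp add: V bij_betw_Pow f(1) inj_on_imp_bij_betw)
  also have "\<dots> = (\<Sum>T\<in>Pow (verts \<Gamma>). Poly_Mapping.single
    (iso_class_of (induced \<Gamma> T), iso_class_of (induced \<Gamma> (verts \<Gamma> - T))) 1)"
  proof (rule sum.cong[OF refl])
    fix T assume "T \<in> Pow (verts \<Gamma>)"
    moreover from this have "verts \<Gamma>' - f ` T = f ` (verts \<Gamma> - T)"
      using f(1) by (simp add: V inj_on_image_set_diff[OF f(1)])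
    ultimately show "Poly_Mapping.single
      (iso_class_of (induced \<Gamma>' (f ` T)), iso_class_of (induced \<Gamma>' (verts \<Gamma>' - f ` T))) (1::'k)
      = Poly_Mapping.single
      (iso_class_of (induced \<Gamma> T), iso_class_of (induced \<Gamma> (verts \<Gamma> - T))) 1"
      by (simp add: ind)
  qed
  finally show ?thesis .
qed

lemma zeta_elem:
  "simplicial_complex \<Gamma> \<Longrightarrow> zeta s (elem \<Gamma>) = (if dimension \<Gamma> < int s then 1 else 0)"
  by (simp add: zeta_def elem_def dimension_representative)

lemma Psi_elem:
  assumes "simplicial_complex \<Gamma>"
  shows "Psi \<zeta> (elem \<Gamma>) = (\<lambda>m. \<Sum>\<alpha>\<in>compositions (card (verts \<Gamma>)).
    character_at \<zeta> \<alpha> (elem \<Gamma>) * monomial_quasisym \<alpha> m)"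
  by (simp add: Psi_def elem_def num_verts_iso_class_of[OF assms])

lemma finite_compositions: "finite (compositions n)"
proof (rule finite_subset)
  show "compositions n \<subseteq> {\<alpha>. set \<alpha> \<subseteq> {..n} \<and> length \<alpha> \<le> n}"
  proof
    fix \<alpha> assume "\<alpha> \<in> compositions n"
    then have \<alpha>: "0 \<notin> set \<alpha>" "sum_list \<alpha> = n" by (auto simp: compositions_def)
    have "length \<alpha> \<le> sum_list \<alpha>" using \<alpha>(1) by (induction \<alpha>) auto
    then show "\<alpha> \<in> {\<alpha>. set \<alpha> \<subseteq> {..n} \<and> length \<alpha> \<le> n}"
      using \<alpha>(2) member_le_sum_list by auto
  qed
qed (simp add: finite_lists_length_le)

lemma lookup_color_exponent:
  assumes "simplicial_complex \<Gamma>"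
  shows "Poly_Mapping.lookup (color_exponent \<Gamma> f) i = card {v \<in> verts \<Gamma>. f v = i}"
proof -
  have "{i. card {v \<in> verts \<Gamma>. f v = i} \<noteq> 0} \<subseteq> f ` verts \<Gamma>"
    by (auto simp: card_eq_0_iff)
  then have "finite {i. card {v \<in> verts \<Gamma>. f v = i} \<noteq> 0}"
    using finite_verts[OF assms] finite_subset by blast
  then show ?thesis by (simp add: color_exponent_def)
qed

lemma finite_coloring_fibre:
  assumes "simplicial_complex \<Gamma>"
  shows "finite {f \<in> simplicial_colorings s \<Gamma>. color_exponent \<Gamma> f = m}"
proof (rule finite_subset)
  show "{f \<in> simplicial_colorings s \<Gamma>. color_exponent \<Gamma> f = m}
      \<subseteq> verts \<Gamma> \<rightarrow>\<^sub>E Poly_Mapping.keys m"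
  proof
    fix f assume "f \<in> {f \<in> simplicial_colorings s \<Gamma>. color_exponent \<Gamma> f = m}"
    then have f: "f \<in> verts \<Gamma> \<rightarrow>\<^sub>E {1..}" "m = color_exponent \<Gamma> f"
      by (auto simp: simplicial_colorings_def)
    have "f v \<in> Poly_Mapping.keys m" if "v \<in> verts \<Gamma>" for v
      using that finite_verts[OF assms]
      by (auto simp: f(2) in_keys_iff lookup_color_exponent[OF assms] card_eq_0_iff)
    then show "f \<in> verts \<Gamma> \<rightarrow>\<^sub>E Poly_Mapping.keys m"
      using f(1) by (auto simp: PiE_iff)
  qed
qed (simp add: finite_PiE finite_verts[OF assms])

lemma finite_index_fibre:
  fixes \<alpha> :: "nat list"
  assumes "0 \<notin> set \<alpha>"
  shows "finite {is \<in> index_tuples (length \<alpha>).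
    (\<Sum>j<length \<alpha>. Poly_Mapping.single (is ! j) (\<alpha> ! j)) = m}"
proof (rule finite_subset)
  show "{is \<in> index_tuples (length \<alpha>).
      (\<Sum>j<length \<alpha>. Poly_Mapping.single (is ! j) (\<alpha> ! j)) = m}
      \<subseteq> {is. set is \<subseteq> Poly_Mapping.keys m \<and> length is = length \<alpha>}"
  proof (intro subsetI CollectI conjI)
    fix "is" x
    assume is_mem: "is \<in> {is \<in> index_tuples (length \<alpha>).
      (\<Sum>j<length \<alpha>. Poly_Mapping.single (is ! j) (\<alpha> ! j)) = m}" and "x \<in> set is"
    then have I: "is \<in> index_tuples (length \<alpha>)" "x \<in> set is"
      and m: "m = (\<Sum>j<length \<alpha>. Poly_Mapping.single (is ! j) (\<alpha> ! j))" by auto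
    then have len: "length is = length \<alpha>" by (simp add: index_tuples_def)
    then obtain j where j: "j < length \<alpha>" "x = is ! j" using I(2) by (metis in_set_conv_nth)
    have "\<alpha> ! j \<noteq> 0" using assms j(1) by (metis nth_mem)
    moreover have "Poly_Mapping.lookup (Poly_Mapping.single (is ! j) (\<alpha> ! j)) x
        \<le> (\<Sum>j<length \<alpha>. Poly_Mapping.lookup (Poly_Mapping.single (is ! j) (\<alpha> ! j)) x)"
      using j(1) by (intro member_le_sum) auto
    ultimately have "0 < Poly_Mapping.lookup
        (\<Sum>j<length \<alpha>. Poly_Mapping.single (is ! j) (\<alpha> ! j)) x"
      by (simp add: lookup_sum j(2))
    then show "x \<in> Poly_Mapping.keys m" by (simp add: in_keys_iff m)
  qed (auto simp: index_tuples_def)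
qed (simp add: finite_lists_length_eq)

end

theory Submission
  imports Defs
begin

text \<open>The iterated coproduct of \<open>\<Gamma>\<close> is a sum over all maps \<open>g\<close> from the vertices to
  \<open>{..<k}\<close>, so \<open>\<zeta>\<^bsub>s,\<alpha>\<^esub>(\<Gamma>)\<close> counts those maps whose fibre sizes are prescribed by \<open>\<alpha>\<close> and
  whose fibres meet every face in at most \<open>s\<close> vertices. A coloring \<open>f\<close> factors uniquely as such a
  surjection \<open>g\<close> followed by an increasing enumeration \<open>i\<^sub>1 < \<dots> < i\<^sub>k\<close> of its colors; the latter
  is the choice of a monomial of \<open>M\<^bsub>\<alpha>\<^esub>\<close>.\<close>

section \<open>Additivity of linear forms and linear extensions\<close>

lemma linear_form_superset:
  assumes "finite A" "Poly_Mapping.keys h \<subseteq> A"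
  shows "linear_form \<phi> h = (\<Sum>a\<in>A. Poly_Mapping.lookup h a * \<phi> a)"
  unfolding linear_form_def
  by (rule sum.mono_neutral_left) (use assms in \<open>auto simp: in_keys_iff\<close>)

lemma linear_form_0 [simp]: "linear_form \<phi> 0 = 0"
  by (simp add: linear_form_def)

lemma linear_form_add: "linear_form \<phi> (g + h) = linear_form \<phi> g + linear_form \<phi> h"
proof -
  \<comment> \<open>Cancellation can shrink the support of \<open>g + h\<close>, but it stays inside
    this union, so all three forms become sums over one index set.\<close>
  let ?A = "Poly_Mapping.keys g \<union> Poly_Mapping.keys h"
  have *: "linear_form \<phi> x = (\<Sum>a\<in>?A. Poly_Mapping.lookup x a * \<phi> a)"
    if "Poly_Mapping.keys x \<subseteq> ?A" for x
    by (rule linear_form_superset) (use that in auto)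
  show ?thesis
    using Poly_Mapping.keys_add[of g h]
    by (simp add: * lookup_add sum.distrib distrib_right)
qed

lemma linear_form_sum: "linear_form \<phi> (\<Sum>i\<in>I. h i) = (\<Sum>i\<in>I. linear_form \<phi> (h i))"
  by (induction I rule: infinite_finite_induct) (auto simp: linear_form_add)

text \<open>Transfers the additivity of linear forms to linear extensions, one coefficient at a
  time.\<close>

lemma lookup_linear_extension:
  "Poly_Mapping.lookup (linear_extension f h) b =
     linear_form (\<lambda>a. Poly_Mapping.lookup (f a) b) h"
  unfolding linear_extension_def linear_form_def lookup_sum
  by (intro sum.cong refl) (simp add: Poly_Mapping.map.rep_eq when_def)

lemma linear_extension_sum:
  "linear_extension f (\<Sum>i\<in>I. h i) = (\<Sum>i\<in>I. linear_extension f (h i))"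
  by (rule poly_mapping_eqI) (simp add: lookup_linear_extension linear_form_sum lookup_sum)

lemma linear_extension_sum_single:
  "linear_extension f (\<Sum>i\<in>I. Poly_Mapping.single (a i) 1) = (\<Sum>i\<in>I. f (a i))"
  by (simp add: linear_extension_sum)

section \<open>Induced subcomplexes, dimension and fibres\<close>

lemma induced_induced: "induced (induced \<Gamma> A) T = induced \<Gamma> (A \<inter> T)"
  by (simp add: induced_def Setcompr_eq_image image_image Int_assoc)

lemma induced_verts [simp]: "induced \<Gamma> (verts \<Gamma>) = \<Gamma>"
proof -
  have "X \<inter> verts \<Gamma> = X" if "X \<in> \<Gamma>" for X
    using that by (auto simp: verts_def)
  then show ?thesis by (simp add: induced_def Setcompr_eq_image)
qed

text \<open>The \<open>- 1\<close> in the dimension of a face turns the strict bound into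
  \<open>\<le>\<close>, the form in which colorings state it. The maximum exists because
  \<open>{}\<close> is a face.\<close>

lemma dimension_less_iff:
  assumes "simplicial_complex \<Gamma>"
  shows "dimension \<Gamma> < int s \<longleftrightarrow> (\<forall>X\<in>\<Gamma>. card X \<le> s)"
proof -
  have "finite \<Gamma>" "\<Gamma> \<noteq> {}" using assms by (auto simp: simplicial_complex_def)
  then show ?thesis unfolding dimension_def by (subst Max_less_iff) auto
qed

text \<open>The restriction to vertices matters: outside them an extensional map takes the value
  \<open>undefined\<close>, which is itself a natural number and could equal
  \<open>j\<close>.\<close>

definition fibre :: "'v set set \<Rightarrow> ('v \<Rightarrow> nat) \<Rightarrow> nat \<Rightarrow> 'v set" where
  "fibre \<Gamma> g j = {v \<in> verts \<Gamma>. g v = j}"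

lemma fibre_subset: "fibre \<Gamma> g j \<subseteq> verts \<Gamma>"
  by (auto simp: fibre_def)

section \<open>The iterated coproduct as a sum over maps\<close>

lemma coproduct_head_single:
  assumes "simplicial_complex \<Gamma>" "A \<subseteq> verts \<Gamma>"
  shows "coproduct_head (Poly_Mapping.single (iso_class_of (induced \<Gamma> A) # ds) (1::'k::field)) =
    (\<Sum>T\<in>Pow A. Poly_Mapping.single
      (iso_class_of (induced \<Gamma> T) # iso_class_of (induced \<Gamma> (A - T)) # ds) 1)"
proof -
  have V: "verts (induced \<Gamma> A) = A" using assms(2) by (auto simp: verts_induced)
  have "coproduct (Poly_Mapping.single (iso_class_of (induced \<Gamma> A)) (1::'k)) =
    (\<Sum>T\<in>Pow A. Poly_Mapping.single
      (iso_class_of (induced (induced \<Gamma> A) T), iso_class_of (induced (induced \<Gamma> A) (A - T))) 1)"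
    using coproduct_elem[OF simplicial_complex_induced[OF assms(1), of A], where 'k='k]
    by (simp add: V elem_def)
  \<comment> \<open>Inducing twice is inducing on the intersection, so every tensor factor remains
    an induced subcomplex of the original \<open>\<Gamma>\<close>.\<close>
  also have "\<dots> = (\<Sum>T\<in>Pow A. Poly_Mapping.single
      (iso_class_of (induced \<Gamma> T), iso_class_of (induced \<Gamma> (A - T))) 1)"
    by (intro sum.cong) (auto simp: induced_induced Int_absorb1)
  finally show ?thesis
    unfolding coproduct_head_def by (simp add: linear_extension_sum_single)
qed

text \<open>One more coproduct on the first factor cuts the fibre over 0 in two: \<open>T\<close>
  keeps the index 0, its complement gets the index 1, and all later fibres move up by one.\<close>

lemma bij_betw_split_first_fibre:
  "bij_betw (\<lambda>(g, T). \<lambda>v\<in>verts \<Gamma>. if v \<in> T then 0 else Suc (g v))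
     (SIGMA g:verts \<Gamma> \<rightarrow>\<^sub>E {..<Suc k}. Pow (fibre \<Gamma> g 0)) (verts \<Gamma> \<rightarrow>\<^sub>E {..<Suc (Suc k)})"
  (is "bij_betw ?split ?P ?H")
\<comment> \<open>The inverse merges the fibres of \<open>h\<close> over 0 and 1 by truncated
  subtraction and remembers the former fibre over 0 as \<open>T\<close>.\<close>
proof (rule bij_betw_byWitness[where f' = "\<lambda>h. (\<lambda>v\<in>verts \<Gamma>. h v - 1, fibre \<Gamma> h 0)"])
  show "\<forall>p\<in>?P. (\<lambda>v\<in>verts \<Gamma>. ?split p v - 1, fibre \<Gamma> (?split p) 0) = p"
  proof
    fix p assume "p \<in> ?P"
    then obtain g T where p: "p = (g, T)" and g: "g \<in> verts \<Gamma> \<rightarrow>\<^sub>E {..<Suc k}"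
      and T: "T \<subseteq> fibre \<Gamma> g 0" by blast
    have "(\<lambda>v\<in>verts \<Gamma>. ?split p v - 1) = g"
    proof
      \<comment> \<open>Outside the vertex set both sides are \<open>undefined\<close>, by
        extensionality of \<open>g\<close>.\<close>
      show "(\<lambda>v\<in>verts \<Gamma>. ?split p v - 1) v = g v" for v
        using T PiE_arb[OF g, of v] by (auto simp: p fibre_def)
    qed
    moreover have "fibre \<Gamma> (?split p) 0 = T" using T by (auto simp: p fibre_def)
    ultimately show "(\<lambda>v\<in>verts \<Gamma>. ?split p v - 1, fibre \<Gamma> (?split p) 0) = p"
      using p by (simp only: prod.inject)
  qed
  show "\<forall>h\<in>?H. ?split (\<lambda>v\<in>verts \<Gamma>. h v - 1, fibre \<Gamma> h 0) = h"
  proof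
    fix h assume h: "h \<in> ?H"
    show "?split (\<lambda>v\<in>verts \<Gamma>. h v - 1, fibre \<Gamma> h 0) = h"
    proof
      show "?split (\<lambda>v\<in>verts \<Gamma>. h v - 1, fibre \<Gamma> h 0) v = h v" for v
        using PiE_arb[OF h, of v] by (simp add: fibre_def)
    qed
  qed
  show "?split ` ?P \<subseteq> ?H"
    by (fastforce simp: PiE_iff split: if_splits)
  show "(\<lambda>h. (\<lambda>v\<in>verts \<Gamma>. h v - 1, fibre \<Gamma> h 0)) ` ?H \<subseteq> ?P"
    by (fastforce simp: PiE_iff fibre_def)
qed

lemma iterated_coproduct_elem:
  assumes "simplicial_complex \<Gamma>"
  shows "iterated_coproduct k (elem \<Gamma> :: 'k::field alg) =
    (\<Sum>g\<in>verts \<Gamma> \<rightarrow>\<^sub>E {..<k}.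
       Poly_Mapping.single (map (\<lambda>j. iso_class_of (induced \<Gamma> (fibre \<Gamma> g j))) [0..<k]) 1)"
\<comment> \<open>The cases follow the recursion of \<open>iterated_coproduct\<close>, which starts
  afresh at \<open>k = 1\<close>; the counit at \<open>k = 0\<close> does not feed into it.\<close>
proof (induction k rule: induct_nat_012)
  case 0
  \<comment> \<open>The counit is 1 exactly when there are no vertices, the only case in which a map
    into the empty set exists.\<close>
  have "counit (elem \<Gamma> :: 'k alg) = (if verts \<Gamma> = {} then 1 else 0)"
    using finite_verts[OF assms]
    by (simp add: counit_def elem_def num_verts_iso_class_of[OF assms])
  moreover have "verts \<Gamma> \<rightarrow>\<^sub>E {..<0::nat} = {}" if "verts \<Gamma> \<noteq> {}"
    using that by (auto simp: PiE_eq_empty_iff)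
  ultimately show ?case by auto
next
  case 1
  \<comment> \<open>With one factor only the constant map remains, and its single fibre is the whole
    vertex set.\<close>
  have "fibre \<Gamma> (\<lambda>v\<in>verts \<Gamma>. 0) 0 = verts \<Gamma>" by (auto simp: fibre_def)
  moreover have "verts \<Gamma> \<rightarrow>\<^sub>E {..<Suc 0} = {\<lambda>v\<in>verts \<Gamma>. 0}"
  proof -
    have "verts \<Gamma> \<rightarrow>\<^sub>E {..<Suc 0} = (\<Pi>\<^sub>E v\<in>verts \<Gamma>. {(\<lambda>v\<in>verts \<Gamma>. 0) v})"
      by (intro PiE_cong) auto
    then show ?thesis by (simp only: PiE_singleton restrict_extensional)
  qed
  ultimately show ?case by (simp add: elem_def del: restrict_apply)
next
  case (ge2 k)
  let ?V = "verts \<Gamma>"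
  let ?c = "\<lambda>g j. iso_class_of (induced \<Gamma> (fibre \<Gamma> g j))"
  let ?split = "\<lambda>(g, T). \<lambda>v\<in>?V. if v \<in> T then 0 else Suc (g v)"
  let ?P = "SIGMA g:?V \<rightarrow>\<^sub>E {..<Suc k}. Pow (fibre \<Gamma> g 0)"
  have fin: "finite (?V \<rightarrow>\<^sub>E {..<Suc k})" "\<And>g. finite (Pow (fibre \<Gamma> g 0))"
    using finite_verts[OF assms] by (auto simp: fibre_def intro!: finite_PiE)
  \<comment> \<open>\<open>upt_Suc\<close> would split off the last entry, whereas
    \<open>coproduct_head\<close> acts on the first.\<close>
  have upt: "map h [0..<Suc n] = h 0 # map (\<lambda>j. h (Suc j)) [0..<n]" for h :: "nat \<Rightarrow> iso_class" and n
    by (simp add: upt_conv_Cons map_Suc_upt[symmetric] del: upt_Suc)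
  \<comment> \<open>By linearity the coproduct acts on each summand separately, and only on the
    factor of the fibre over 0.\<close>
  have "iterated_coproduct (Suc (Suc k)) (elem \<Gamma> :: 'k alg) =
    (\<Sum>g\<in>?V \<rightarrow>\<^sub>E {..<Suc k}. coproduct_head
      (Poly_Mapping.single (?c g 0 # map (\<lambda>j. ?c g (Suc j)) [0..<k]) 1))"
    by (simp add: ge2.IH(2) upt del: upt_Suc)
      (simp add: coproduct_head_def linear_extension_sum)
  also have "\<dots> = (\<Sum>(g, T)\<in>?P. Poly_Mapping.single
      (iso_class_of (induced \<Gamma> T) # iso_class_of (induced \<Gamma> (fibre \<Gamma> g 0 - T))
        # map (\<lambda>j. ?c g (Suc j)) [0..<k]) 1)"
    unfolding coproduct_head_single[OF assms fibre_subset]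
    by (rule sum.Sigma) (simp_all add: fin del: finite_Pow_iff)
  also have "\<dots> = (\<Sum>p\<in>?P. Poly_Mapping.single (map (?c (?split p)) [0..<Suc (Suc k)]) 1)"
  proof (intro sum.cong refl)
    fix p assume "p \<in> ?P"
    then obtain g T where p: "p = (g, T)" and T: "T \<subseteq> fibre \<Gamma> g 0" by auto
    have "fibre \<Gamma> (?split p) 0 = T" "fibre \<Gamma> (?split p) (Suc 0) = fibre \<Gamma> g 0 - T"
      "\<And>j. fibre \<Gamma> (?split p) (Suc (Suc j)) = fibre \<Gamma> g (Suc j)"
      using T by (auto simp: p fibre_def)
    then show "(case p of (g, T) \<Rightarrow> Poly_Mapping.single
        (iso_class_of (induced \<Gamma> T) # iso_class_of (induced \<Gamma> (fibre \<Gamma> g 0 - T))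
          # map (\<lambda>j. ?c g (Suc j)) [0..<k]) (1::'k))
      = Poly_Mapping.single (map (?c (?split p)) [0..<Suc (Suc k)]) 1"
      by (simp add: p upt del: upt_Suc)
  qed
  also have "\<dots> = (\<Sum>h\<in>?V \<rightarrow>\<^sub>E {..<Suc (Suc k)}.
      Poly_Mapping.single (map (?c h) [0..<Suc (Suc k)]) 1)"
    by (rule sum.reindex_bij_betw[OF bij_betw_split_first_fibre])
  finally show ?case .
qed

section \<open>The value of the character at a composition\<close>

definition typed_maps :: "nat \<Rightarrow> 'v set set \<Rightarrow> nat list \<Rightarrow> ('v \<Rightarrow> nat) set" where
  "typed_maps s \<Gamma> \<alpha> = {g \<in> verts \<Gamma> \<rightarrow>\<^sub>E {..<length \<alpha>}.
     \<forall>j<length \<alpha>. card (fibre \<Gamma> g j) = \<alpha> ! j \<and> (\<forall>X\<in>\<Gamma>. card (X \<inter> fibre \<Gamma> g j) \<le> s)}"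

text \<open>The projection keeps the summands with fibre sizes \<open>\<alpha>\<close>. On each
  factor \<open>zeta s\<close> is 0 or 1, so the product over the factors is the indicator of all
  face bounds together, and summing indicators counts maps.\<close>

lemma character_at_zeta_elem:
  assumes "simplicial_complex \<Gamma>"
  shows "character_at (zeta s) \<alpha> (elem \<Gamma> :: 'k::field alg) = of_nat (card (typed_maps s \<Gamma> \<alpha>))"
proof -
  let ?M = "verts \<Gamma> \<rightarrow>\<^sub>E {..<length \<alpha>}"
  let ?cs = "\<lambda>g. map (\<lambda>j. iso_class_of (induced \<Gamma> (fibre \<Gamma> g j))) [0..<length \<alpha>]"
  have sc: "simplicial_complex (induced \<Gamma> T)" for T
    using assms by (rule simplicial_complex_induced)
  have fin: "finite ?M" using finite_verts[OF assms] by (auto intro: finite_PiE)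
  have num: "num_verts (iso_class_of (induced \<Gamma> (fibre \<Gamma> g j))) = card (fibre \<Gamma> g j)" for g j
    by (simp add: num_verts_iso_class_of sc verts_induced Int_absorb1 fibre_subset)
  have type: "map num_verts (?cs g) = \<alpha> \<longleftrightarrow> (\<forall>j<length \<alpha>. card (fibre \<Gamma> g j) = \<alpha> ! j)" for g
    by (subst list_eq_iff_nth_eq) (simp add: num)
  have zeta: "zeta s (Poly_Mapping.single (iso_class_of (induced \<Gamma> T)) (1::'k)) =
      (if \<forall>X\<in>\<Gamma>. card (X \<inter> T) \<le> s then 1 else 0)" for T
  proof -
    have "(\<forall>X\<in>induced \<Gamma> T. card X \<le> s) \<longleftrightarrow> (\<forall>X\<in>\<Gamma>. card (X \<inter> T) \<le> s)"
      by (simp add: induced_def Setcompr_eq_image)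
    then show ?thesis
      by (simp add: zeta_elem[OF sc] dimension_less_iff[OF sc] flip: elem_def)
  qed
  have prod: "(\<Prod>c\<leftarrow>?cs g. zeta s (Poly_Mapping.single c (1::'k))) =
      (if \<forall>j<length \<alpha>. \<forall>X\<in>\<Gamma>. card (X \<inter> fibre \<Gamma> g j) \<le> s then 1 else 0)" for g
  proof -
    \<comment> \<open>A product of indicators is the indicator of the conjunction.\<close>
    have "(\<Prod>j\<leftarrow>[0..<n]. if P j then 1 else (0::'k)) = (if \<forall>j<n. P j then 1 else 0)" for n P
      by (induction n) (auto simp: less_Suc_eq)
    then show ?thesis by (simp add: zeta comp_def)
  qed
  have "character_at (zeta s) \<alpha> (elem \<Gamma> :: 'k alg) =
    (\<Sum>g\<in>?M. linear_form (\<lambda>cs. \<Prod>c\<leftarrow>cs. zeta s (Poly_Mapping.single c 1))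
      (if map num_verts (?cs g) = \<alpha> then Poly_Mapping.single (?cs g) 1 else 0 :: 'k tensor))"
    unfolding character_at_def tensor_power_form_def graded_projection_def
    by (simp only: iterated_coproduct_elem[OF assms] linear_extension_sum_single linear_form_sum)
  also have "\<dots> = (\<Sum>g\<in>?M. if g \<in> typed_maps s \<Gamma> \<alpha> then 1 else 0)"
  proof (rule sum.cong[OF refl])
    fix g assume "g \<in> ?M"
    then show "linear_form (\<lambda>cs. \<Prod>c\<leftarrow>cs. zeta s (Poly_Mapping.single c 1))
      (if map num_verts (?cs g) = \<alpha> then Poly_Mapping.single (?cs g) 1 else 0 :: 'k tensor) =
      (if g \<in> typed_maps s \<Gamma> \<alpha> then 1 else 0)"
      unfolding if_distrib[where f="linear_form _"] linear_form_single prod type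
      by (auto simp: typed_maps_def)
  qed
  also have "\<dots> = of_nat (card (?M \<inter> typed_maps s \<Gamma> \<alpha>))"
    using fin by (simp add: sum.If_cases)
  also have "?M \<inter> typed_maps s \<Gamma> \<alpha> = typed_maps s \<Gamma> \<alpha>" by (auto simp: typed_maps_def)
  finally show ?thesis .
qed

section \<open>Colorings as compositions with index tuples and typed maps\<close>

lemma lookup_sum_single_nth:
  assumes "distinct is" "length is = n" "j < n"
  shows "Poly_Mapping.lookup (\<Sum>j<n. Poly_Mapping.single (is ! j) (e j)) (is ! j) = e j"
proof -
  have "Poly_Mapping.lookup (\<Sum>j<n. Poly_Mapping.single (is ! j) (e j)) (is ! j) =
      (\<Sum>i<n. if i = j then e i else 0)"
    unfolding lookup_sum
    by (intro sum.cong) (use assms in \<open>auto simp: lookup_single when_def nth_eq_iff_index_eq\<close>)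
  then show ?thesis using assms(3) by simp
qed

lemma lookup_sum_single_notin:
  assumes "length is = n" "i \<notin> set is"
  shows "Poly_Mapping.lookup (\<Sum>j<n. Poly_Mapping.single (is ! j) (e j)) i = 0"
  using assms by (auto simp: lookup_sum lookup_single when_def intro!: sum.neutral)

text \<open>The index tuples that contribute the monomial with exponent \<open>m\<close> to
  \<open>M_\<alpha>\<close>; their number gives its coefficient.\<close>

definition exponent_tuples :: "nat list \<Rightarrow> (nat \<Rightarrow>\<^sub>0 nat) \<Rightarrow> nat list set" where
  "exponent_tuples \<alpha> m = {is \<in> index_tuples (length \<alpha>).
     (\<Sum>j<length \<alpha>. Poly_Mapping.single (is ! j) (\<alpha> ! j)) = m}"

text \<open>Distinct positions in \<open>is\<close> carry distinct colors, so renaming the values of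
  \<open>g\<close> by these colors does not merge fibres.\<close>

lemma fibre_nth:
  assumes "g \<in> verts \<Gamma> \<rightarrow>\<^sub>E {..<length is}" "distinct is" "j < length is"
  shows "fibre \<Gamma> (\<lambda>v\<in>verts \<Gamma>. is ! g v) (is ! j) = fibre \<Gamma> g j"
  using assms by (auto simp: fibre_def PiE_iff nth_eq_iff_index_eq)

lemma fibre_nth_notin:
  assumes "g \<in> verts \<Gamma> \<rightarrow>\<^sub>E {..<length is}" "i \<notin> set is"
  shows "fibre \<Gamma> (\<lambda>v\<in>verts \<Gamma>. is ! g v) i = {}"
  using assms by (auto simp: fibre_def PiE_iff)

text \<open>Faces consist of vertices, so the bounds in \<open>simplicial_colorings\<close> and in
  \<open>typed_maps\<close> concern the same sets.\<close>

lemma face_fibre: "X \<in> \<Gamma> \<Longrightarrow> {v \<in> X. f v = i} = X \<inter> fibre \<Gamma> f i"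
  by (auto simp: fibre_def verts_def)

lemma lookup_color_exponent_fibre:
  "simplicial_complex \<Gamma> \<Longrightarrow>
     Poly_Mapping.lookup (color_exponent \<Gamma> f) i = card (fibre \<Gamma> f i)"
  by (simp add: lookup_color_exponent fibre_def)

text \<open>A coloring determines its factorization: \<open>is\<close> must list its colors in
  increasing order, \<open>g\<close> must give the position of each color in that list, and
  \<open>\<alpha>\<close> must record the fibre sizes. The exponent \<open>m\<close> then becomes a
  condition on \<open>\<alpha>\<close> and \<open>is\<close> alone, the face bound one on
  \<open>g\<close> alone.\<close>

lemma bij_betw_factor_coloring:
  assumes sc: "simplicial_complex \<Gamma>"
  shows "bij_betw (\<lambda>(\<alpha>, is, g). \<lambda>v\<in>verts \<Gamma>. is ! g v)
    (SIGMA \<alpha>:compositions (card (verts \<Gamma>)). exponent_tuples \<alpha> m \<times> typed_maps s \<Gamma> \<alpha>)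
    {f \<in> simplicial_colorings s \<Gamma>. color_exponent \<Gamma> f = m}"
  (is "bij_betw ?F ?P ?C")
proof -
  let ?V = "verts \<Gamma>"
  have finV: "finite ?V" using finite_verts[OF sc] .
  have P: "0 \<notin> set \<alpha>" "sum_list \<alpha> = card ?V" "length is = length \<alpha>" "sorted_wrt (<) is"
    "distinct is" "set is \<subseteq> {1..}" "g \<in> ?V \<rightarrow>\<^sub>E {..<length is}"
    "m = (\<Sum>j<length \<alpha>. Poly_Mapping.single (is ! j) (\<alpha> ! j))"
    "\<And>j. j < length \<alpha> \<Longrightarrow> card (fibre \<Gamma> g j) = \<alpha> ! j"
    "\<And>j X. j < length \<alpha> \<Longrightarrow> X \<in> \<Gamma> \<Longrightarrow> card (X \<inter> fibre \<Gamma> g j) \<le> s"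
    if "(\<alpha>, is, g) \<in> ?P" for \<alpha> "is" g
    using that
    by (auto simp: compositions_def exponent_tuples_def index_tuples_def typed_maps_def
        strict_sorted_iff)
  \<comment> \<open>The parts of a composition are positive, so no fibre of \<open>g\<close> is
    empty and every color listed in \<open>is\<close> is used.\<close>
  have set_is: "set is = ?F (\<alpha>, is, g) ` ?V" if p: "(\<alpha>, is, g) \<in> ?P" for \<alpha> "is" g
  proof
    note P = P[OF p]
    show "?F (\<alpha>, is, g) ` ?V \<subseteq> set is" using P(7) by (auto simp: PiE_iff)
    show "set is \<subseteq> ?F (\<alpha>, is, g) ` ?V"
    proof
      fix i assume "i \<in> set is"
      then obtain j where j: "j < length is" "i = is ! j" by (auto simp: in_set_conv_nth)
      then have "card (fibre \<Gamma> g j) \<noteq> 0" using P(1,3,9) by (metis nth_mem)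
      then obtain v where "v \<in> ?V" "g v = j" by (auto simp: fibre_def card_eq_0_iff)
      then show "i \<in> ?F (\<alpha>, is, g) ` ?V" using j(2) by auto
    qed
  qed
  have "inj_on ?F ?P"
  proof (rule inj_onI)
    fix p q assume p': "p \<in> ?P" and q': "q \<in> ?P" and eq: "?F p = ?F q"
    obtain \<alpha> "is" g where p: "p = (\<alpha>, is, g)" by (cases p)
    obtain \<beta> js h where q: "q = (\<beta>, js, h)" by (cases q)
    note Pp = P[OF p'[unfolded p]] and Pq = P[OF q'[unfolded q]]
    have "set is = ?F p ` ?V" "set js = ?F q ` ?V"
      unfolding p q using set_is[OF p'[unfolded p]] set_is[OF q'[unfolded q]] by blast+
    then have "set is = set js" using eq by (simp only:)
    \<comment> \<open>A strictly increasing list is determined by its set of entries, here the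
      common image of the two equal colorings.\<close>
    then have "is": "is = js"
      using Pp(4) Pq(4) by (simp add: strict_sorted_equal)
    have "g = h"
    proof
      fix v show "g v = h v"
      proof (cases "v \<in> ?V")
        case True
        then have "is ! g v = is ! h v" using fun_cong[OF eq, of v] by (simp add: p q "is")
        then show ?thesis
          using True Pp(5,7) Pq(7) by (auto simp: "is" PiE_iff nth_eq_iff_index_eq)
      next
        case False
        then show ?thesis using PiE_arb[OF Pp(7) False] PiE_arb[OF Pq(7) False] by simp
      qed
    qed
    moreover have "\<alpha> = \<beta>"
    proof (rule nth_equalityI)
      show "length \<alpha> = length \<beta>" using Pp(3) Pq(3) by (simp add: "is")
      then show "\<alpha> ! j = \<beta> ! j" if "j < length \<alpha>" for j
        using Pp(9)[OF that] Pq(9)[of j] that by (simp add: \<open>g = h\<close>)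
    qed
    ultimately show "p = q" by (simp add: p q "is")
  qed
  moreover have "?F ` ?P \<subseteq> ?C"
  proof (rule image_subsetI)
    fix p assume p': "p \<in> ?P"
    obtain \<alpha> "is" g where p: "p = (\<alpha>, is, g)" by (cases p)
    note P = P[OF p'[unfolded p]]
    define f where "f = (\<lambda>v\<in>?V. is ! g v)"
    \<comment> \<open>A listed color occupies exactly one fibre of \<open>g\<close> and any other
      color occupies none; the face bound and the exponent are both read off from this
      distinction.\<close>
    have fib: "fibre \<Gamma> f (is ! j) = fibre \<Gamma> g j" if "j < length is" for j
      unfolding f_def using P(7,5) that by (rule fibre_nth)
    have fib_notin: "fibre \<Gamma> f i = {}" if "i \<notin> set is" for i
      unfolding f_def using P(7) that by (rule fibre_nth_notin)
    have "f \<in> ?V \<rightarrow>\<^sub>E {1..}"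
      unfolding f_def using P(6,7) by (auto simp: PiE_iff subset_iff)
    moreover have "card {v \<in> X. f v = i} \<le> s" if "X \<in> \<Gamma>" for X i
    proof (cases "i \<in> set is")
      case True
      then obtain j where "j < length is" "i = is ! j" by (auto simp: in_set_conv_nth)
      then show ?thesis
        using P(3,10) that unfolding face_fibre[OF that] by (simp add: fib)
    next
      case False
      then show ?thesis unfolding face_fibre[OF that] by (simp add: fib_notin)
    qed
    moreover have "color_exponent \<Gamma> f = m"
    proof (rule poly_mapping_eqI)
      fix i
      show "Poly_Mapping.lookup (color_exponent \<Gamma> f) i = Poly_Mapping.lookup m i"
      proof (cases "i \<in> set is")
        case True
        then obtain j where "j < length is" "i = is ! j" by (auto simp: in_set_conv_nth)
        then show ?thesis
          using P(3,5,9)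
          by (simp add: lookup_color_exponent_fibre sc fib P(8) lookup_sum_single_nth)
      next
        case False
        then show ?thesis
          using P(3)
          by (simp add: lookup_color_exponent_fibre sc fib_notin P(8) lookup_sum_single_notin)
      qed
    qed
    ultimately show "?F p \<in> ?C" by (simp add: p simplicial_colorings_def f_def)
  qed
  moreover have "?C \<subseteq> ?F ` ?P"
  proof
    fix f assume "f \<in> ?C"
    then have f: "f \<in> ?V \<rightarrow>\<^sub>E {1..}" "color_exponent \<Gamma> f = m"
      and face: "\<And>X i. X \<in> \<Gamma> \<Longrightarrow> i \<ge> 1 \<Longrightarrow> card (X \<inter> fibre \<Gamma> f i) \<le> s"
      by (auto simp: simplicial_colorings_def face_fibre)
    define "is" where "is = sorted_list_of_set (f ` ?V)"
    have set_is: "set is = f ` ?V" and dist: "distinct is" and sorted: "sorted_wrt (<) is"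
      using finV by (auto simp: is_def)
    define \<alpha> where "\<alpha> = map (\<lambda>i. card (fibre \<Gamma> f i)) is"
    \<comment> \<open>The choice is a position of the color of \<open>v\<close> in
      \<open>is\<close>, which exists because \<open>is\<close> lists the image of \<open>f\<close>
      and is unique because \<open>is\<close> is distinct.\<close>
    define g where "g = (\<lambda>v\<in>?V. SOME j. j < length is \<and> is ! j = f v)"
    have g: "g v < length is \<and> is ! g v = f v" if "v \<in> ?V" for v
    proof -
      have "\<exists>j. j < length is \<and> is ! j = f v"
        using that set_is by (metis imageI in_set_conv_nth)
      then show ?thesis unfolding g_def using that by simp (rule someI_ex)
    qed
    have g_mem: "g \<in> ?V \<rightarrow>\<^sub>E {..<length is}" using g by (auto simp: g_def PiE_iff)
    have f_eq: "f = (\<lambda>v\<in>?V. is ! g v)"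
    proof
      fix v
      show "f v = (\<lambda>v\<in>?V. is ! g v) v" using g[of v] PiE_arb[OF f(1), of v] by (cases "v \<in> ?V") auto
    qed
    have fib: "fibre \<Gamma> g j = fibre \<Gamma> f (is ! j)" if "j < length is" for j
      using fibre_nth[OF g_mem dist that] f_eq by simp
    \<comment> \<open>Index tuples need positive entries, and the face bound on colorings is
      available for positive colors; both come from the codomain of \<open>f\<close>.\<close>
    have ge1: "i \<ge> 1" if "i \<in> set is" for i using that f(1) by (auto simp: set_is PiE_iff)
    have "sum_list \<alpha> = (\<Sum>i\<in>f ` ?V. card (fibre \<Gamma> f i))"
      using dist by (simp add: \<alpha>_def sum_list_distinct_conv_sum_set set_is)
    also have "\<dots> = card ?V"
      \<comment> \<open>With the constant 1 as summand this counts the vertices color by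
        color.\<close>
      using sum.image_gen[OF finV, of "\<lambda>_. 1::nat" f] by (simp add: fibre_def)
    \<comment> \<open>Only colors that occur are listed, so no fibre size is 0.\<close>
    finally have "\<alpha> \<in> compositions (card ?V)"
      using finV by (auto simp: compositions_def \<alpha>_def set_is fibre_def card_eq_0_iff)
    moreover have "is \<in> exponent_tuples \<alpha> m"
    proof -
      have "(\<Sum>j<length is. Poly_Mapping.single (is ! j) (\<alpha> ! j)) = color_exponent \<Gamma> f"
      proof (rule poly_mapping_eqI)
        fix i
        show "Poly_Mapping.lookup (\<Sum>j<length is. Poly_Mapping.single (is ! j) (\<alpha> ! j)) i =
            Poly_Mapping.lookup (color_exponent \<Gamma> f) i"
        proof (cases "i \<in> set is")
          case True
          then obtain j where "j < length is" "i = is ! j" by (auto simp: in_set_conv_nth)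
          then show ?thesis
            by (simp add: lookup_color_exponent_fibre sc lookup_sum_single_nth dist \<alpha>_def)
        next
          case False
          then have "fibre \<Gamma> f i = {}" by (auto simp: set_is fibre_def)
          then show ?thesis
            by (simp add: lookup_color_exponent_fibre sc lookup_sum_single_notin False)
        qed
      qed
      then show ?thesis
        using sorted ge1 by (auto simp: exponent_tuples_def index_tuples_def f(2) \<alpha>_def)
    qed
    moreover have "g \<in> typed_maps s \<Gamma> \<alpha>"
      using g_mem face ge1 by (auto simp: typed_maps_def \<alpha>_def fib)
    ultimately show "f \<in> ?F ` ?P"
      by (intro image_eqI[of _ _ "(\<alpha>, is, g)"]) (auto simp: f_eq)
  qed
  ultimately show ?thesis by (auto simp: bij_betw_def)
qed

section \<open>Comparison of coefficients\<close>

theorem theorem4p2: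
  fixes \<Gamma> :: "'v set set" and s :: nat
  assumes "s \<ge> 1" and "simplicial_complex \<Gamma>"
  shows "Psi (zeta s) (elem \<Gamma> :: 'k::field alg) = chromatic_series s \<Gamma>"
proof
  fix m :: "nat \<Rightarrow>\<^sub>0 nat"
  let ?n = "card (verts \<Gamma>)"
  have fin_maps: "finite (typed_maps s \<Gamma> \<alpha>)" for \<alpha>
    unfolding typed_maps_def using finite_verts[OF assms(2)]
    by (intro finite_subset[OF Collect_restrict]) (simp add: finite_PiE)
  \<comment> \<open>Since the parts of \<open>\<alpha>\<close> are positive, each index of such a
    tuple lies in the finite support of \<open>m\<close>.\<close>
  have fin_tuples: "finite (exponent_tuples \<alpha> m)" if "\<alpha> \<in> compositions ?n" for \<alpha>
    using finite_index_fibre[of \<alpha> m] that by (simp add: exponent_tuples_def compositions_def)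
  \<comment> \<open>Each summand is a product of two counts, hence the count of a product set. Both
    sides of the theorem are thus images of natural numbers under \<open>of_nat\<close>, so a
    bijection settles the identity in every characteristic.\<close>
  have "Psi (zeta s) (elem \<Gamma> :: 'k alg) m =
      (\<Sum>\<alpha>\<in>compositions ?n. of_nat (card (exponent_tuples \<alpha> m \<times> typed_maps s \<Gamma> \<alpha>)))"
    by (simp add: Psi_elem assms(2) character_at_zeta_elem monomial_quasisym_def monomial_sum_def
        exponent_tuples_def card_cartesian_product mult.commute)
  also have "\<dots> = of_nat (card (SIGMA \<alpha>:compositions ?n.
      exponent_tuples \<alpha> m \<times> typed_maps s \<Gamma> \<alpha>))"
    using fin_maps fin_tuples by (simp add: card_SigmaI finite_compositions)
  also have "\<dots> = chromatic_series s \<Gamma> m"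
    using bij_betw_same_card[OF bij_betw_factor_coloring[OF assms(2), of m s]]
    by (simp add: chromatic_series_def monomial_sum_def)
  finally show "Psi (zeta s) (elem \<Gamma> :: 'k alg) m = chromatic_series s \<Gamma> m" .
qed

end
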